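(* Let $f\colon M\to M$ be a homeomorphism of a compact metric space $(M,d)$. The following are equivalent: (1) $f$ is topologically hyperbolic, i.e. $f$ is expansive and has the shadowing property; (2) $f$ admits a shadowing map which is shift-invariant and dynamically-invariant.
   Context: $\tilde M=M^{\mathbb Z}$ has the product topology; $\sigma\colon\tilde M\to\tilde M$ is the shift, $(\sigma(x))_i=x_{i+1}$; for $p\in M$, $\mathrm{orb}_f(p)\in\tilde M$ is given by $(\mathrm{orb}_f(p))_i=f^i(p)$. For $\delta\ge 0$, $\tilde M(f,\delta)=\{x\in\tilde M: d(x_{i+1},f(x_i))\le\delta\ \forall i\in\mathbb Z\}$; its elements are called $\delta$-orbits. A point $p$ is an $\epsilon$-shadow of $x$ if $d(f^i(p),x_i)\le\epsilon$ for all $i\in\mathbb Z$. $f$ has the shadowing property if for all $\epsilon>0$ there is $\delta>0$ such that every $\delta$-orbit has an $\epsilon$-shadow. $f$ is expansive if there is $\xi>0$ such that $p\neq q$ implies $d(f^i(p),f^i(q))>\xi$ for some $i\in\mathbb Z$. A pseudo-orbit map for $f$ is a continuous map $\mathrm{Sh}_f\colon\tilde M(f,\delta)\to M$ (for some $\delta>0$) with $\mathrm{Sh}_f(\mathrm{orb}_f(p))=p$ for all $p\in M$. It is a shadowing map if moreover for all $\epsilon>0$ there is $\gamma\in(0,\delta]$ such that $d(f^i(\mathrm{Sh}_f(x)),\mathrm{Sh}_f(\sigma^i(x)))\le\epsilon$ for all $x\in\tilde M(f,\gamma)$ and $i\in\mathbb Z$. A pseudo-orbit map is shift-invariant if, for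 some $\delta>0$, $\mathrm{Sh}_f\circ\sigma=f\circ\mathrm{Sh}_f$ on $\tilde M(f,\delta)$. Let $f$ act on $\tilde M$ by $f(x)_i=f(x_i)$. A map $\mathrm{Sh}_f\colon\tilde M(f,\epsilon)\to M$ is dynamically-invariant if $f(\mathrm{Sh}_f(x))=\mathrm{Sh}_f(f(x))$ for all $x\in\tilde M(f,\delta)$, for some $\delta\in(0,\epsilon]$ such that $f(x)\in\tilde M(f,\epsilon)$ for every $x\in\tilde M(f,\delta)$. *)

theory Defs
  imports "HOL-Analysis.Analysis"
begin

text \<open>The space \<^emph>\<open>M\<close> is a type \<^typ>\<open>'a\<close>; sequences are functions \<^typ>\<open>int \<Rightarrow> 'a\<close>, whose
  topology is the product topology of \<^theory>\<open>HOL-Analysis.Function_Topology\<close>. A map defined on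
  \<open>pseudo_orbits f \<delta>\<close> is a total function together with \<open>\<delta>\<close>; only its values on that set are
  ever used.\<close>

text \<open>Integer iterates; meaningful for bijective \<open>f\<close>.\<close>

definition int_iter :: "('b \<Rightarrow> 'b) \<Rightarrow> int \<Rightarrow> 'b \<Rightarrow> 'b" where
  "int_iter f i = (if 0 \<le> i then f ^^ nat i else (inv f) ^^ nat (- i))"

definition seq_shift :: "(int \<Rightarrow> 'a) \<Rightarrow> (int \<Rightarrow> 'a)" where
  "seq_shift x = (\<lambda>i. x (i + 1))"

definition orb :: "('a \<Rightarrow> 'a) \<Rightarrow> 'a \<Rightarrow> (int \<Rightarrow> 'a)" where
  "orb f p = (\<lambda>i. int_iter f i p)"

definition seq_act :: "('a \<Rightarrow> 'a) \<Rightarrow> (int \<Rightarrow> 'a) \<Rightarrow> (int \<Rightarrow> 'a)" where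
  "seq_act f x = (\<lambda>i. f (x i))"

definition pseudo_orbits :: "('a::metric_space \<Rightarrow> 'a) \<Rightarrow> real \<Rightarrow> (int \<Rightarrow> 'a) set" where
  "pseudo_orbits f \<delta> = {x. \<forall>i. dist (x (i + 1)) (f (x i)) \<le> \<delta>}"

definition shadow :: "('a::metric_space \<Rightarrow> 'a) \<Rightarrow> real \<Rightarrow> (int \<Rightarrow> 'a) \<Rightarrow> 'a \<Rightarrow> bool" where
  "shadow f \<epsilon> x p \<longleftrightarrow> (\<forall>i. dist (int_iter f i p) (x i) \<le> \<epsilon>)"

definition shadowing_property :: "('a::metric_space \<Rightarrow> 'a) \<Rightarrow> bool" where
  "shadowing_property f \<longleftrightarrow>
     (\<forall>\<epsilon>>0. \<exists>\<delta>>0. \<forall>x \<in> pseudo_orbits f \<delta>. \<exists>p. shadow f \<epsilon> x p)"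

definition expansive :: "('a::metric_space \<Rightarrow> 'a) \<Rightarrow> bool" where
  "expansive f \<longleftrightarrow>
     (\<exists>\<xi>>0. \<forall>p q. p \<noteq> q \<longrightarrow> (\<exists>i. dist (int_iter f i p) (int_iter f i q) > \<xi>))"

definition topologically_hyperbolic :: "('a::metric_space \<Rightarrow> 'a) \<Rightarrow> bool" where
  "topologically_hyperbolic f \<longleftrightarrow> expansive f \<and> shadowing_property f"

definition pseudo_orbit_map ::
    "('a::metric_space \<Rightarrow> 'a) \<Rightarrow> real \<Rightarrow> ((int \<Rightarrow> 'a) \<Rightarrow> 'a) \<Rightarrow> bool" where
  "pseudo_orbit_map f \<delta> Sh \<longleftrightarrow>
     \<delta> > 0 \<and> continuous_on (pseudo_orbits f \<delta>) Sh \<and> (\<forall>p. Sh (orb f p) = p)"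

definition shadowing_map ::
    "('a::metric_space \<Rightarrow> 'a) \<Rightarrow> real \<Rightarrow> ((int \<Rightarrow> 'a) \<Rightarrow> 'a) \<Rightarrow> bool" where
  "shadowing_map f \<delta> Sh \<longleftrightarrow>
     pseudo_orbit_map f \<delta> Sh \<and>
     (\<forall>\<epsilon>>0. \<exists>\<gamma>. 0 < \<gamma> \<and> \<gamma> \<le> \<delta> \<and>
        (\<forall>x \<in> pseudo_orbits f \<gamma>. \<forall>i.
           dist (int_iter f i (Sh x)) (Sh (int_iter seq_shift i x)) \<le> \<epsilon>))"

text \<open>In the next two definitions, \<open>\<delta>\<close> is the parameter of the domain of \<open>Sh\<close>, and the identity
  is required on \<open>pseudo_orbits f \<gamma>\<close> for some possibly smaller \<open>\<gamma>\<close>.\<close>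

definition shift_invariant ::
    "('a::metric_space \<Rightarrow> 'a) \<Rightarrow> real \<Rightarrow> ((int \<Rightarrow> 'a) \<Rightarrow> 'a) \<Rightarrow> bool" where
  "shift_invariant f \<delta> Sh \<longleftrightarrow>
     (\<exists>\<gamma>. 0 < \<gamma> \<and> \<gamma> \<le> \<delta> \<and> (\<forall>x \<in> pseudo_orbits f \<gamma>. Sh (seq_shift x) = f (Sh x)))"

definition dynamically_invariant ::
    "('a::metric_space \<Rightarrow> 'a) \<Rightarrow> real \<Rightarrow> ((int \<Rightarrow> 'a) \<Rightarrow> 'a) \<Rightarrow> bool" where
  "dynamically_invariant f \<delta> Sh \<longleftrightarrow>
     (\<exists>\<gamma>. 0 < \<gamma> \<and> \<gamma> \<le> \<delta> \<and>
        (\<forall>x \<in> pseudo_orbits f \<gamma>. seq_act f x \<in> pseudo_orbits f \<delta>) \<and>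
        (\<forall>x \<in> pseudo_orbits f \<gamma>. f (Sh x) = Sh (seq_act f x)))"

lemma int_iter_seq_shift: "int_iter seq_shift i x = (\<lambda>j. x (j + i))"
proof -
  have inv: "inv seq_shift = (\<lambda>(x :: int \<Rightarrow> 'a) i. x (i - 1))"
    by (rule inv_equality) (simp_all add: seq_shift_def)
  have "(seq_shift ^^ n) x = (\<lambda>j. x (j + int n))" for n
    by (induction n) (simp_all add: seq_shift_def ac_simps)
  moreover have "(inv seq_shift ^^ n) x = (\<lambda>j. x (j - int n))" for n
    by (induction n) (simp_all add: inv algebra_simps)
  ultimately show ?thesis
    by (simp add: int_iter_def)
qed

end

theory Submission
  imports Defs
begin

text \<open>If \<open>f\<close> is topologically hyperbolic, with expansivity constant \<open>\<xi>\<close>, let \<open>Sh x\<close> be the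
  \<open>\<xi>/2\<close>-shadow of \<open>x\<close>, which expansivity makes unique. The relation ``\<open>p\<close> is a
  \<open>\<xi>/2\<close>-shadow of \<open>x\<close>'' is closed in a compact space and so is the graph of a continuous map
  (lemma \<open>continuous_on_if_compact_graph\<close>). The
  two invariances hold because \<open>f (Sh x)\<close> is a \<open>\<xi>/2\<close>-shadow both of the shift of \<open>x\<close> and, when the
  jumps of \<open>x\<close> are small enough, of the image of \<open>x\<close> under \<open>f\<close>.

  Conversely, let \<open>Sh\<close> have both invariances. Pseudo-orbits with small jumps are close to genuine
  orbits, so by compactness \<open>Sh x\<close> is close to \<open>x 0\<close> (lemma \<open>pseudo_orbit_map_near_base_point\<close>);
  shift invariance carries this estimate to every time, and \<open>Sh x\<close> shadows \<open>x\<close>. For expansivity,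
  suppose that the orbits of \<open>p\<close> and \<open>q\<close> stay close at all times. Following \<open>p\<close> before time \<open>k\<close> and
  \<open>q\<close> from time \<open>k\<close> on gives a pseudo-orbit \<open>y\<^sub>k\<close> with small jumps. The image of \<open>y\<^sub>k\<close> under \<open>f\<close> is
  the shift of \<open>y\<^sub>k\<^sub>+\<^sub>1\<close>, so \<open>f (Sh y\<^sub>k) = f (Sh y\<^sub>k\<^sub>+\<^sub>1)\<close> by the two invariances: \<open>Sh y\<^sub>k\<close> does not
  depend on \<open>k\<close>. But \<open>y\<^sub>k\<close> tends to the orbit of \<open>p\<close> as \<open>k \<rightarrow> \<infinity>\<close> and to that of \<open>q\<close> as
  \<open>k \<rightarrow> -\<infinity>\<close>, and by continuity the constant value is both \<open>p\<close> and \<open>q\<close>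
  (lemma \<open>expansive_if_shift_and_dynamically_invariant\<close>).\<close>

section \<open>Two-sided orbits\<close>

lemma int_iter_plus_one:
  assumes "bij f"
  shows "int_iter f (i + 1) p = f (int_iter f i p)"
proof (cases "0 \<le> i")
  case True
  then show ?thesis by (simp add: int_iter_def nat_add_distrib)
next
  case False
  then have "nat (- i) = Suc (nat (- (i + 1)))" by simp
  then have "f ((inv f ^^ nat (- i)) p) = (inv f ^^ nat (- (i + 1))) p"
    by (simp add: bij_is_surj[OF assms] surj_f_inv_f)
  moreover have "i + 1 = 0" if "0 \<le> i + 1" using False that by simp
  ultimately show ?thesis
    using False by (auto simp: int_iter_def)
qed

text \<open>The recursion also determines the past of \<open>x\<close> because \<open>f\<close> is injective. Identities that hold at
  every integer time thus follow from a single forward step.\<close>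

lemma eq_orb_if_recursion:
  assumes "bij f" "\<And>i. x (i + 1) = f (x i)"
  shows "x = orb f (x 0)"
proof
  fix i
  show "x i = orb f (x 0) i"
  proof (induction i rule: int_induct[where k = 0])
    case base
    show ?case by (simp add: orb_def int_iter_def)
  next
    case (step1 i)
    then show ?case by (simp add: orb_def int_iter_plus_one assms)
  next
    case (step2 i)
    then have "f (x (i - 1)) = f (orb f (x 0) (i - 1))"
      using assms(2)[of "i - 1"] int_iter_plus_one[OF assms(1), of "i - 1"]
      by (simp add: orb_def)
    then show ?case using assms(1) by (metis bij_is_inj injD)
  qed
qed

lemma int_iter_image:
  assumes "bij f"
  shows "int_iter f i (f p) = f (int_iter f i p)"
proof -
  have "(\<lambda>i. f (int_iter f i p)) = orb f (f (int_iter f 0 p))"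
    by (rule eq_orb_if_recursion[OF assms]) (simp add: int_iter_plus_one assms)
  then show ?thesis by (simp add: orb_def int_iter_def fun_eq_iff)
qed

lemma continuous_on_int_iter:
  assumes "homeomorphism UNIV UNIV f (inv f)"
  shows "continuous_on UNIV (int_iter f i)"
proof -
  have "continuous_on UNIV (g ^^ n)" if "continuous_on UNIV g" for g :: "'a \<Rightarrow> 'a" and n
    by (induction n) (auto simp: id_def intro: continuous_on_compose2[OF that])
  then show ?thesis
    using assms by (auto simp: int_iter_def homeomorphism_def)
qed

section \<open>Spaces of pseudo-orbits\<close>

lemma orb_in_pseudo_orbits:
  assumes "bij f" "0 \<le> \<delta>"
  shows "orb f p \<in> pseudo_orbits f \<delta>"
  using assms by (simp add: pseudo_orbits_def orb_def int_iter_plus_one)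

lemma pseudo_orbits_mono:
  assumes "\<gamma> \<le> \<delta>"
  shows "pseudo_orbits f \<gamma> \<subseteq> pseudo_orbits f \<delta>"
  using order_trans[OF _ assms] by (auto simp: pseudo_orbits_def)

lemma translate_in_pseudo_orbits:
  assumes "x \<in> pseudo_orbits f \<delta>"
  shows "(\<lambda>j. x (j + i)) \<in> pseudo_orbits f \<delta>"
  unfolding pseudo_orbits_def
proof (intro CollectI allI)
  fix j
  have "dist (x (j + i + 1)) (f (x (j + i))) \<le> \<delta>"
    using assms by (simp add: pseudo_orbits_def)
  then show "dist (x (j + 1 + i)) (f (x (j + i))) \<le> \<delta>"
    by (simp add: ac_simps)
qed

lemma compact_UNIV_fun:
  assumes "compact (UNIV :: 'a::topological_space set)"
  shows "compact (UNIV :: ('i \<Rightarrow> 'a) set)"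
proof -
  have "compact_space (product_topology (\<lambda>i. euclidean :: 'a topology) (UNIV :: 'i set))"
    using assms unfolding compact_space_product_topology by (simp add: compact_space_def)
  then show ?thesis
    by (simp add: euclidean_product_topology compact_space_def)
qed

lemma compact_if_closed_in_compact_UNIV:
  assumes "compact (UNIV :: 'a::topological_space set)" "closed (S :: 'a set)"
  shows "compact S"
  using compact_Int_closed[OF assms] by (simp only: Int_UNIV_left)

lemma continuous_on_coordinate: "continuous_on S (\<lambda>x. x i :: 'b::topological_space)"
  by (rule continuous_on_subset[OF continuous_on_product_coordinates subset_UNIV])

lemma closed_pseudo_orbits:
  assumes "continuous_on UNIV f"
  shows "closed (pseudo_orbits f \<delta>)"
proof -
  have "continuous_on UNIV (\<lambda>x. f (x i))" for i :: int
    by (rule continuous_on_compose2[OF assms]) (auto intro: continuous_on_coordinate)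
  then have "closed {x. dist (x (i + 1)) (f (x i)) \<le> \<delta>}" for i :: int
    by (intro closed_Collect_le[OF continuous_on_dist[OF continuous_on_coordinate]]
        continuous_on_const)
  then show ?thesis
    unfolding pseudo_orbits_def by (intro closed_Collect_all)
qed

lemma tendsto_fun_if_coordinates_eventually_eq:
  fixes y :: "nat \<Rightarrow> 'i \<Rightarrow> 'a::topological_space"
  assumes "\<And>i. \<forall>\<^sub>F n in sequentially. y n i = l i"
  shows "y \<longlonglongrightarrow> l"
proof -
  have "(\<lambda>n. y n i) \<longlonglongrightarrow> l i" for i
    by (rule tendsto_eventually[OF assms])
  then have "limitin (product_topology (\<lambda>i. euclidean) UNIV) y l sequentially"
    by (simp add: limitin_componentwise)
  then show ?thesis by (simp add: euclidean_product_topology)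
qed

text \<open>Shift invariance passes from one step to all integer times because translates of pseudo-orbits,
  backward ones included, are again pseudo-orbits.\<close>

lemma int_iter_eq_translate_if_shift_invariant:
  assumes "bij f" and x: "x \<in> pseudo_orbits f \<gamma>"
    and shift: "\<And>x. x \<in> pseudo_orbits f \<gamma> \<Longrightarrow> Sh (seq_shift x) = f (Sh x)"
  shows "int_iter f i (Sh x) = Sh (\<lambda>j. x (j + i))"
proof -
  let ?z = "\<lambda>i. Sh (\<lambda>j. x (j + i))"
  have "?z (i + 1) = f (?z i)" for i
    using shift[OF translate_in_pseudo_orbits[OF x, of i]]
    by (simp add: seq_shift_def ac_simps)
  then have "?z = orb f (?z 0)"
    by (rule eq_orb_if_recursion[OF assms(1)])
  then show ?thesis by (simp add: orb_def fun_eq_iff)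
qed

section \<open>From hyperbolicity to an invariant shadowing map\<close>

lemma continuous_on_if_compact_graph:
  fixes g :: "'a::t2_space \<Rightarrow> 'b::t2_space"
  assumes "compact {(x, p). x \<in> S \<and> p = g x}" (is "compact ?G")
  shows "continuous_on S g"
proof -
  \<comment> \<open>The first projection is a continuous bijection from the compact graph onto \<open>S\<close>.\<close>
  have "continuous_on (fst ` ?G) (\<lambda>x. (x, g x))"
    using assms by (intro continuous_on_inv continuous_on_fst continuous_on_id) auto
  moreover have "fst ` ?G = S" by force
  ultimately have "continuous_on S (\<lambda>x. snd (x, g x))"
    by (intro continuous_on_snd) simp
  then show ?thesis by simp
qed

lemma expansive_shadow_unique:
  assumes "\<And>p q. p \<noteq> q \<Longrightarrow> \<exists>i. \<xi> < dist (int_iter f i p) (int_iter f i q)"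
    and "shadow f \<epsilon> x p" "shadow f \<epsilon>' x q" "\<epsilon> + \<epsilon>' \<le> \<xi>"
  shows "p = q"
proof (rule ccontr)
  assume "p \<noteq> q"
  then obtain i where "\<xi> < dist (int_iter f i p) (int_iter f i q)" using assms(1) by blast
  also have "\<dots> \<le> dist (int_iter f i p) (x i) + dist (int_iter f i q) (x i)"
    by (rule dist_triangle2)
  also have "\<dots> \<le> \<xi>"
    using assms(2-4) unfolding shadow_def by (smt (verit))
  finally show False by simp
qed

lemma invariant_shadowing_map_if_hyperbolic:
  fixes f :: "'a::metric_space \<Rightarrow> 'a"
  assumes compact: "compact (UNIV :: 'a set)"
    and hom: "homeomorphism UNIV UNIV f (inv f)"
    and "bij f"
    and hyp: "topologically_hyperbolic f"
  shows "\<exists>\<delta> Sh. shadowing_map f \<delta> Sh \<and> shift_invariant f \<delta> Sh \<and> dynamically_invariant f \<delta> Sh"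
proof -
  have cont: "continuous_on UNIV f" using hom by (simp add: homeomorphism_def)
  obtain \<xi> where "\<xi> > 0"
    and \<xi>: "\<And>p q. p \<noteq> q \<Longrightarrow> \<exists>i. \<xi> < dist (int_iter f i p) (int_iter f i q)"
    using hyp by (auto simp: topologically_hyperbolic_def expansive_def)
  have shadowing: "\<exists>\<delta>>0. \<forall>x \<in> pseudo_orbits f \<delta>. \<exists>p. shadow f \<epsilon> x p" if "\<epsilon> > 0" for \<epsilon>
    using hyp that by (auto simp: topologically_hyperbolic_def shadowing_property_def)
  define \<epsilon> where "\<epsilon> = \<xi> / 2"
  have "\<epsilon> > 0" using \<open>\<xi> > 0\<close> by (simp add: \<epsilon>_def)
  obtain \<delta> where "\<delta> > 0" and \<delta>: "\<forall>x \<in> pseudo_orbits f \<delta>. \<exists>p. shadow f \<epsilon> x p"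
    using shadowing[OF \<open>\<epsilon> > 0\<close>] by blast
  then obtain Sh where Sh: "\<And>x. x \<in> pseudo_orbits f \<delta> \<Longrightarrow> shadow f \<epsilon> x (Sh x)"
    by metis
  have Sh_eq: "Sh x = p" if "x \<in> pseudo_orbits f \<delta>" "shadow f \<epsilon>' x p" "\<epsilon>' \<le> \<epsilon>" for x p \<epsilon>'
    by (rule expansive_shadow_unique[OF \<xi> Sh[OF that(1)] that(2)]) (use that(3) in \<open>simp_all add: \<epsilon>_def\<close>)

  have "continuous_on (pseudo_orbits f \<delta>) Sh"
  proof (rule continuous_on_if_compact_graph)
    have graph: "{(x, p). x \<in> pseudo_orbits f \<delta> \<and> p = Sh x}
        = (pseudo_orbits f \<delta> \<times> UNIV) \<inter>
          {xp. \<forall>i. dist (int_iter f i (snd xp)) ((fst xp) i) \<le> \<epsilon>}"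
      using Sh Sh_eq[OF _ _ order_refl] by (fastforce simp: shadow_def)
    have "closed {xp :: (int \<Rightarrow> 'a) \<times> 'a.
        \<forall>i. dist (int_iter f i (snd xp)) ((fst xp) i) \<le> \<epsilon>}"
    proof -
      have "continuous_on UNIV (\<lambda>xp :: (int \<Rightarrow> 'a) \<times> 'a. int_iter f i (snd xp))" for i
        by (rule continuous_on_compose2[OF continuous_on_int_iter[OF hom]])
          (auto intro: continuous_on_snd continuous_on_id)
      moreover have "continuous_on UNIV (\<lambda>xp :: (int \<Rightarrow> 'a) \<times> 'a. (fst xp) i)" for i
        by (rule continuous_on_compose2[OF continuous_on_coordinate[of UNIV]])
          (auto intro: continuous_on_fst continuous_on_id)
      ultimately show ?thesis
        by (intro closed_Collect_all closed_Collect_le[OF continuous_on_dist] continuous_on_const)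
    qed
    moreover have "compact (pseudo_orbits f \<delta> \<times> (UNIV :: 'a set))"
      by (intro compact_Times compact compact_if_closed_in_compact_UNIV[OF compact_UNIV_fun]
          closed_pseudo_orbits cont)
    ultimately show "compact {(x, p). x \<in> pseudo_orbits f \<delta> \<and> p = Sh x}"
      unfolding graph by (rule compact_Int_closed[rotated])
  qed
  moreover have "Sh (orb f p) = p" for p
    by (rule Sh_eq[OF orb_in_pseudo_orbits[OF \<open>bij f\<close>] _ order_refl])
      (use \<open>\<delta> > 0\<close> \<open>\<epsilon> > 0\<close> in \<open>simp_all add: shadow_def orb_def\<close>)
  ultimately have map: "pseudo_orbit_map f \<delta> Sh"
    using \<open>\<delta> > 0\<close> by (simp add: pseudo_orbit_map_def)

  have shift: "Sh (seq_shift x) = f (Sh x)" if x: "x \<in> pseudo_orbits f \<delta>" for x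
  proof (rule Sh_eq[OF _ _ order_refl])
    show "seq_shift x \<in> pseudo_orbits f \<delta>"
      using translate_in_pseudo_orbits[OF x, of 1] by (simp add: seq_shift_def)
    show "shadow f \<epsilon> (seq_shift x) (f (Sh x))"
      using Sh[OF x] by (simp add: shadow_def seq_shift_def int_iter_image \<open>bij f\<close>
          flip: int_iter_plus_one[OF \<open>bij f\<close>])
  qed
  have "shadowing_map f \<delta> Sh"
    unfolding shadowing_map_def
  proof (intro conjI map allI impI exI[of _ \<delta>] ballI)
    fix e :: real and x i
    assume "e > 0" and x: "x \<in> pseudo_orbits f \<delta>"
    show "dist (int_iter f i (Sh x)) (Sh (int_iter seq_shift i x)) \<le> e"
      using \<open>e > 0\<close> by (simp add: int_iter_seq_shift
          int_iter_eq_translate_if_shift_invariant[where Sh = Sh, OF \<open>bij f\<close> x shift])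
  qed (use \<open>\<delta> > 0\<close> in auto)
  moreover have "shift_invariant f \<delta> Sh"
    unfolding shift_invariant_def using \<open>\<delta> > 0\<close> shift by blast
  moreover have "dynamically_invariant f \<delta> Sh"
  proof -
    have "uniformly_continuous_on UNIV f"
      by (rule compact_uniformly_continuous[OF cont compact])
    then obtain \<eta>' where "\<eta>' > 0"
      and \<eta>': "\<And>a b. dist a b < \<eta>' \<Longrightarrow> dist (f a) (f b) < min \<delta> \<epsilon>"
      using \<open>\<delta> > 0\<close> \<open>\<epsilon> > 0\<close> unfolding uniformly_continuous_on_def
      by (metis UNIV_I min_less_iff_conj)
    define \<eta> where "\<eta> = \<eta>' / 2"
    have "\<eta> > 0" using \<open>\<eta>' > 0\<close> by (simp add: \<eta>_def)
    have \<eta>: "dist (f a) (f b) \<le> min \<delta> \<epsilon>" if "dist a b \<le> \<eta>" for a b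
      using \<eta>'[of a b] that \<open>\<eta>' > 0\<close> by (simp add: \<eta>_def)
    \<comment> \<open>Small jumps make \<open>Sh x\<close> an \<open>\<eta>\<close>-shadow, which \<open>f\<close> maps to an \<open>\<epsilon>\<close>-shadow.\<close>
    obtain \<beta> where "\<beta> > 0" and \<beta>: "\<forall>x \<in> pseudo_orbits f \<beta>. \<exists>p. shadow f (min \<eta> \<epsilon>) x p"
      using shadowing[of "min \<eta> \<epsilon>"] \<open>\<eta> > 0\<close> \<open>\<epsilon> > 0\<close> by auto
    define \<gamma> where "\<gamma> = min \<delta> (min \<eta> \<beta>)"
    have act: "seq_act f x \<in> pseudo_orbits f \<delta>" if "x \<in> pseudo_orbits f \<gamma>" for x
      unfolding pseudo_orbits_def seq_act_def
    proof (intro CollectI allI)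
      fix i
      have "dist (x (i + 1)) (f (x i)) \<le> \<eta>"
        using that by (simp add: pseudo_orbits_def \<gamma>_def)
      from \<eta>[OF this] show "dist (f (x (i + 1))) (f (f (x i))) \<le> \<delta>" by simp
    qed
    have "Sh (seq_act f x) = f (Sh x)" if x: "x \<in> pseudo_orbits f \<gamma>" for x
    proof -
      have "x \<in> pseudo_orbits f \<delta>" "x \<in> pseudo_orbits f \<beta>"
        using x by (simp_all add: pseudo_orbits_def \<gamma>_def)
      then obtain p where p: "shadow f (min \<eta> \<epsilon>) x p" "Sh x = p"
        using \<beta> Sh_eq[of x "min \<eta> \<epsilon>"] by fastforce
      have "shadow f \<epsilon> (seq_act f x) (f p)"
        unfolding shadow_def seq_act_def
      proof
        fix i
        have "dist (int_iter f i p) (x i) \<le> \<eta>"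
          using p(1) by (simp add: shadow_def)
        from \<eta>[OF this] show "dist (int_iter f i (f p)) (f (x i)) \<le> \<epsilon>"
          by (simp add: int_iter_image \<open>bij f\<close>)
      qed
      then show ?thesis
        using Sh_eq[OF act[OF x] _ order_refl] p(2) by simp
    qed
    moreover have "0 < \<gamma>" "\<gamma> \<le> \<delta>"
      using \<open>\<delta> > 0\<close> \<open>\<eta> > 0\<close> \<open>\<beta> > 0\<close> by (simp_all add: \<gamma>_def)
    ultimately show ?thesis
      unfolding dynamically_invariant_def using act by metis
  qed
  ultimately show ?thesis by blast
qed

section \<open>From an invariant pseudo-orbit map to hyperbolicity\<close>

text \<open>The sets of \<open>1/(n+1)\<close>-pseudo-orbits on which the estimate fails are closed and decrease with
  \<open>n\<close>. A common element would be a genuine orbit, where \<open>Sh x = x 0\<close>; hence one of them is empty.\<close>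

lemma pseudo_orbit_map_near_base_point:
  fixes f :: "'a::metric_space \<Rightarrow> 'a"
  assumes compact: "compact (UNIV :: 'a set)" and cont: "continuous_on UNIV f" and "bij f"
    and map: "pseudo_orbit_map f \<delta> Sh" and "\<epsilon> > 0"
  shows "\<exists>\<gamma>. 0 < \<gamma> \<and> \<gamma> \<le> \<delta> \<and> (\<forall>x \<in> pseudo_orbits f \<gamma>. dist (Sh x) (x 0) < \<epsilon>)"
proof (rule ccontr)
  assume none: "\<not> ?thesis"
  define \<gamma> where "\<gamma> n = min \<delta> (inverse (real (Suc n)))" for n
  have "\<delta> > 0" and cSh: "continuous_on (pseudo_orbits f \<delta>) Sh"
    and Sh_orb: "\<And>p. Sh (orb f p) = p"
    using map by (auto simp: pseudo_orbit_map_def)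
  define F where "F n = {x \<in> pseudo_orbits f (\<gamma> n). \<epsilon> \<le> dist (Sh x) (x 0)}" for n
  have "\<gamma> n > 0" "\<gamma> n \<le> \<delta>" for n using \<open>\<delta> > 0\<close> by (simp_all add: \<gamma>_def)
  then have nonempty: "F n \<noteq> {}" for n
    using none by (fastforce simp: F_def not_less)
  have closed: "closed (F n)" for n
  proof -
    have "closed (pseudo_orbits f (\<gamma> n))" by (rule closed_pseudo_orbits[OF cont])
    moreover have "continuous_on (pseudo_orbits f (\<gamma> n)) (\<lambda>x. dist (Sh x) (x 0))"
      by (intro continuous_on_dist continuous_on_coordinate
          continuous_on_subset[OF cSh] pseudo_orbits_mono \<open>\<gamma> n \<le> \<delta>\<close>)
    ultimately show ?thesis
      using continuous_closed_preimage[of _ _ "{\<epsilon>..}"]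
      by (fastforce simp: F_def vimage_def Int_def)
  qed
  have decreasing: "F n \<subseteq> F m" if "m \<le> n" for m n
  proof -
    have "\<gamma> n \<le> \<gamma> m" using that unfolding \<gamma>_def
      by (intro min.mono le_imp_inverse_le) simp_all
    then show ?thesis using pseudo_orbits_mono[of "\<gamma> n" "\<gamma> m" f] by (auto simp: F_def)
  qed
  have "UNIV \<inter> (\<Inter>n\<in>UNIV. F n) \<noteq> {}"
  proof (rule compact_imp_fip_image[OF compact_UNIV_fun[OF compact] closed])
    fix I :: "nat set"
    assume "finite I"
    then have "F (Max I) \<subseteq> (\<Inter>n\<in>I. F n)"
      using decreasing by (blast intro: Max_ge)
    then show "UNIV \<inter> (\<Inter>n\<in>I. F n) \<noteq> {}"
      using nonempty[of "Max I"] by blast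
  qed
  then obtain x where x: "\<And>n. x \<in> F n" by blast
  have "x (i + 1) = f (x i)" for i
  proof -
    have "dist (x (i + 1)) (f (x i)) \<le> inverse (real (Suc n))" for n
      using x[of n] by (simp add: F_def \<gamma>_def pseudo_orbits_def)
    then have "dist (x (i + 1)) (f (x i)) \<le> 0"
      by (intro LIMSEQ_le_const[OF LIMSEQ_inverse_real_of_nat]) auto
    then show ?thesis by simp
  qed
  then have "x = orb f (x 0)" by (rule eq_orb_if_recursion[OF \<open>bij f\<close>])
  then have "Sh x = x 0" using Sh_orb[of "x 0"] by simp
  then show False using x[of 0] \<open>\<epsilon> > 0\<close> by (simp add: F_def)
qed

lemma shadowing_property_if_shift_invariant:
  fixes f :: "'a::metric_space \<Rightarrow> 'a"
  assumes "compact (UNIV :: 'a set)" "continuous_on UNIV f" "bij f"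
    and map: "pseudo_orbit_map f \<delta> Sh" and shift: "shift_invariant f \<delta> Sh"
  shows "shadowing_property f"
  unfolding shadowing_property_def
proof (intro allI impI)
  fix \<epsilon> :: real
  assume "\<epsilon> > 0"
  obtain \<gamma> where "\<gamma> > 0" and \<gamma>: "\<And>x. x \<in> pseudo_orbits f \<gamma> \<Longrightarrow> dist (Sh x) (x 0) < \<epsilon>"
    using pseudo_orbit_map_near_base_point[OF assms(1-3) map \<open>\<epsilon> > 0\<close>] by blast
  obtain \<beta> where "\<beta> > 0" and \<beta>: "\<And>x. x \<in> pseudo_orbits f \<beta> \<Longrightarrow> Sh (seq_shift x) = f (Sh x)"
    using shift by (auto simp: shift_invariant_def)
  have "shadow f \<epsilon> x (Sh x)" if x: "x \<in> pseudo_orbits f (min \<gamma> \<beta>)" for x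
    unfolding shadow_def
  proof
    fix i
    have x': "x \<in> pseudo_orbits f \<gamma>" "x \<in> pseudo_orbits f \<beta>"
      using x by (simp_all add: pseudo_orbits_def)
    have "dist (Sh (\<lambda>j. x (j + i))) (x i) < \<epsilon>"
      using \<gamma>[OF translate_in_pseudo_orbits[OF x'(1), of i]] by simp
    then show "dist (int_iter f i (Sh x)) (x i) \<le> \<epsilon>"
      by (simp add: int_iter_eq_translate_if_shift_invariant[where Sh = Sh, OF \<open>bij f\<close> x'(2) \<beta>])
  qed
  then show "\<exists>\<delta>>0. \<forall>x\<in>pseudo_orbits f \<delta>. \<exists>p. shadow f \<epsilon> x p"
    using \<open>\<gamma> > 0\<close> \<open>\<beta> > 0\<close> by (intro exI[of _ "min \<gamma> \<beta>"]) auto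
qed

text \<open>The pseudo-orbit \<open>y\<^sub>k\<close> of the introduction: follow \<open>x\<close> before time \<open>k\<close>, then \<open>x'\<close>.\<close>

definition switch_at :: "int \<Rightarrow> (int \<Rightarrow> 'a) \<Rightarrow> (int \<Rightarrow> 'a) \<Rightarrow> (int \<Rightarrow> 'a)" where
  "switch_at k x x' = (\<lambda>i. if i < k then x i else x' i)"

lemma seq_act_switch_at_orb:
  assumes "bij f"
  shows "seq_act f (switch_at k (orb f p) (orb f q)) =
    seq_shift (switch_at (k + 1) (orb f p) (orb f q))"
  by (auto simp: seq_act_def seq_shift_def switch_at_def orb_def int_iter_plus_one assms)

lemma switch_at_orb_in_pseudo_orbits:
  assumes "bij f" "0 \<le> \<delta>" "\<And>i. dist (orb f p i) (orb f q i) \<le> \<delta>"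
  shows "switch_at k (orb f p) (orb f q) \<in> pseudo_orbits f \<delta>"
proof -
  have step: "f (orb f r i) = orb f r (i + 1)" for r i
    by (simp add: orb_def int_iter_plus_one assms(1))
  show ?thesis
    using assms(2,3) by (auto simp: pseudo_orbits_def switch_at_def step dist_commute)
qed

lemma switch_at_tendsto:
  shows "(\<lambda>n. switch_at (int n) x x') \<longlonglongrightarrow> x"
    and "(\<lambda>n. switch_at (- int n) x x') \<longlonglongrightarrow> x'"
proof -
  have "\<forall>\<^sub>F n in sequentially. switch_at (int n) x x' i = x i" for i
    using eventually_gt_at_top[of "nat i"] by eventually_elim (auto simp: switch_at_def)
  then show "(\<lambda>n. switch_at (int n) x x') \<longlonglongrightarrow> x"
    by (rule tendsto_fun_if_coordinates_eventually_eq)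
  have "\<forall>\<^sub>F n in sequentially. switch_at (- int n) x x' i = x' i" for i
    using eventually_gt_at_top[of "nat (- i)"] by eventually_elim (auto simp: switch_at_def)
  then show "(\<lambda>n. switch_at (- int n) x x') \<longlonglongrightarrow> x'"
    by (rule tendsto_fun_if_coordinates_eventually_eq)
qed

text \<open>Applying \<open>f\<close> to every entry moves time forward like the shift but keeps the switching time,
  so a map invariant under both cannot see when the switch happens.\<close>

lemma expansive_if_shift_and_dynamically_invariant:
  fixes f :: "'a::metric_space \<Rightarrow> 'a"
  assumes "bij f"
    and map: "pseudo_orbit_map f \<delta> Sh" and shift: "shift_invariant f \<delta> Sh"
    and dyn: "dynamically_invariant f \<delta> Sh"
  shows "expansive f"
proof -
  obtain \<beta> where "\<beta> > 0" "\<beta> \<le> \<delta>"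
    and \<beta>: "\<And>x. x \<in> pseudo_orbits f \<beta> \<Longrightarrow> Sh (seq_shift x) = f (Sh x)"
    using shift by (auto simp: shift_invariant_def)
  obtain \<gamma> where "\<gamma> > 0"
    and \<gamma>: "\<And>x. x \<in> pseudo_orbits f \<gamma> \<Longrightarrow> f (Sh x) = Sh (seq_act f x)"
    using dyn by (auto simp: dynamically_invariant_def)
  have cSh: "continuous_on (pseudo_orbits f \<delta>) Sh" and Sh_orb: "\<And>p. Sh (orb f p) = p"
    and "\<delta> > 0"
    using map by (auto simp: pseudo_orbit_map_def)
  define \<xi> where "\<xi> = min \<beta> \<gamma>"
  have "\<xi> > 0" using \<open>\<beta> > 0\<close> \<open>\<gamma> > 0\<close> by (simp add: \<xi>_def)
  have "p = q" if close: "\<And>i. dist (orb f p i) (orb f q i) \<le> \<xi>" for p q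
  proof -
    define y where "y k = switch_at k (orb f p) (orb f q)" for k
    have y: "y k \<in> pseudo_orbits f \<xi>" for k
      using switch_at_orb_in_pseudo_orbits[OF \<open>bij f\<close> _ close] \<open>\<xi> > 0\<close> by (simp add: y_def)
    then have y': "y k \<in> pseudo_orbits f \<beta>" "y k \<in> pseudo_orbits f \<gamma>"
      "y k \<in> pseudo_orbits f \<delta>" for k
      using pseudo_orbits_mono[of \<xi> \<beta> f] pseudo_orbits_mono[of \<xi> \<gamma> f]
        pseudo_orbits_mono[of \<xi> \<delta> f] \<open>\<beta> \<le> \<delta>\<close> unfolding \<xi>_def by fastforce+
    have step: "Sh (y (k + 1)) = Sh (y k)" for k
    proof -
      have "f (Sh (y (k + 1))) = Sh (seq_shift (y (k + 1)))" by (simp add: \<beta> y')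
      also have "\<dots> = Sh (seq_act f (y k))"
        by (simp add: y_def seq_act_switch_at_orb \<open>bij f\<close>)
      also have "\<dots> = f (Sh (y k))" by (simp add: \<gamma> y')
      finally show ?thesis using \<open>bij f\<close> by (metis bij_is_inj injD)
    qed
    have const: "Sh (y k) = Sh (y 0)" for k
    proof (induction k rule: int_induct[where k = 0])
      case (step1 k)
      then show ?case by (simp add: step)
    next
      case (step2 k)
      then show ?case using step[of "k - 1"] by simp
    qed simp
    have limit: "Sh (y 0) = r" if "(\<lambda>n. y (s n)) \<longlonglongrightarrow> orb f r" for s :: "nat \<Rightarrow> int" and r
    proof -
      have "(\<lambda>n. Sh (y (s n))) \<longlonglongrightarrow> Sh (orb f r)"
        by (rule continuous_on_tendsto_compose[OF cSh that])
          (use \<open>\<delta> > 0\<close> y' in \<open>auto intro: orb_in_pseudo_orbits \<open>bij f\<close>\<close>)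
      then have "(\<lambda>n :: nat. Sh (y 0)) \<longlonglongrightarrow> r" by (simp add: const[of "s _"] Sh_orb)
      then show ?thesis by (simp add: LIMSEQ_const_iff)
    qed
    have "Sh (y 0) = p" "Sh (y 0) = q"
      using limit[of int p] limit[of "\<lambda>n. - int n" q] switch_at_tendsto[of "orb f p" "orb f q"]
      by (simp_all add: y_def)
    then show ?thesis by simp
  qed
  then have "\<exists>i. dist (int_iter f i p) (int_iter f i q) > \<xi>" if "p \<noteq> q" for p q
    using that by (metis linorder_not_le orb_def)
  then show ?thesis unfolding expansive_def using \<open>\<xi> > 0\<close> by blast
qed

section \<open>The equivalence\<close>

theorem theorem7p5:
  fixes f :: "'a::metric_space \<Rightarrow> 'a"
  assumes "compact (UNIV :: 'a set)"
    and "homeomorphism UNIV UNIV f (inv f)"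
  shows "topologically_hyperbolic f \<longleftrightarrow>
    (\<exists>\<delta> Sh. shadowing_map f \<delta> Sh \<and> shift_invariant f \<delta> Sh \<and> dynamically_invariant f \<delta> Sh)"
proof
  have "bij f"
    using assms(2) by (metis UNIV_I bij_iff homeomorphism_def)
  have "continuous_on UNIV f" using assms(2) by (simp add: homeomorphism_def)
  {
    assume "topologically_hyperbolic f"
    then show "\<exists>\<delta> Sh. shadowing_map f \<delta> Sh \<and> shift_invariant f \<delta> Sh \<and> dynamically_invariant f \<delta> Sh"
      by (rule invariant_shadowing_map_if_hyperbolic[OF assms \<open>bij f\<close>])
  next
    assume "\<exists>\<delta> Sh. shadowing_map f \<delta> Sh \<and> shift_invariant f \<delta> Sh \<and> dynamically_invariant f \<delta> Sh"
    then obtain \<delta> Sh where inv: "shift_invariant f \<delta> Sh" "dynamically_invariant f \<delta> Sh"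
      and map: "pseudo_orbit_map f \<delta> Sh"
      by (auto simp: shadowing_map_def)
    show "topologically_hyperbolic f"
      unfolding topologically_hyperbolic_def
      using expansive_if_shift_and_dynamically_invariant[OF \<open>bij f\<close> map inv]
        shadowing_property_if_shift_invariant[OF assms(1) \<open>continuous_on UNIV f\<close> \<open>bij f\<close> map inv(1)]
      by blast
  }
qed

end
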